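(* Let $Y$ be a continuum. If some meager composant of $Y$ is singular dense in $Y$, then every meager composant of $Y$ is dense in $Y$.
   Context: A continuum is a connected compact metrizable space with more than one point. A subcontinuum of a continuum $Y$ is a non-empty compact connected subset of $Y$ (one-point subsets are allowed). For a continuum $Y$ and $x\in Y$, the meager composant of $x$ in $Y$ is the union of all subcontinua of $Y$ that contain $x$ and are nowhere dense in $Y$; a meager composant of $Y$ is the meager composant of some point of $Y$. A connected subset $X$ of a continuum $Y$ is singular with respect to a point $y\in Y$ if for every connected $C\subseteq X$ such that $y$ belongs to the closure of $C$ in $Y$, the closure of $C$ in $X$ equals $X$. $X$ is singular in $Y$ if it is singular with respect to some $y\in Y$, and singular dense in $Y$ if it is both singular in $Y$ and dense in $Y$. *)

theory Defs
  imports "HOL-Analysis.Analysis"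
begin

definition continuum :: "'a topology \<Rightarrow> bool" where
  "continuum Y \<longleftrightarrow>
     connected_space Y \<and> compact_space Y \<and> metrizable_space Y \<and>
     (\<exists>a \<in> topspace Y. \<exists>b \<in> topspace Y. a \<noteq> b)"

(* One-point sets are allowed, unlike in the definition of a continuum. *)
definition subcontinuum :: "'a topology \<Rightarrow> 'a set \<Rightarrow> bool" where
  "subcontinuum Y K \<longleftrightarrow> K \<noteq> {} \<and> compactin Y K \<and> connectedin Y K"

definition nowhere_dense_in :: "'a topology \<Rightarrow> 'a set \<Rightarrow> bool" where
  "nowhere_dense_in Y S \<longleftrightarrow> S \<subseteq> topspace Y \<and> Y interior_of (Y closure_of S) = {}"

definition dense_in :: "'a topology \<Rightarrow> 'a set \<Rightarrow> bool" where
  "dense_in Y S \<longleftrightarrow> S \<subseteq> topspace Y \<and> Y closure_of S = topspace Y"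

definition meager_composant_of :: "'a topology \<Rightarrow> 'a \<Rightarrow> 'a set" where
  "meager_composant_of Y x = \<Union>{K. subcontinuum Y K \<and> nowhere_dense_in Y K \<and> x \<in> K}"

definition meager_composant :: "'a topology \<Rightarrow> 'a set \<Rightarrow> bool" where
  "meager_composant Y X \<longleftrightarrow> (\<exists>x \<in> topspace Y. X = meager_composant_of Y x)"

definition singular_wrt :: "'a topology \<Rightarrow> 'a set \<Rightarrow> 'a \<Rightarrow> bool" where
  "singular_wrt Y X y \<longleftrightarrow>
     connectedin Y X \<and> y \<in> topspace Y \<and>
     (\<forall>C. C \<subseteq> X \<and> connectedin Y C \<and> y \<in> Y closure_of C \<longrightarrow>
          subtopology Y X closure_of C = X)"

definition singular_in :: "'a topology \<Rightarrow> 'a set \<Rightarrow> bool" where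
  "singular_in Y X \<longleftrightarrow> (\<exists>y \<in> topspace Y. singular_wrt Y X y)"

definition singular_dense_in :: "'a topology \<Rightarrow> 'a set \<Rightarrow> bool" where
  "singular_dense_in Y X \<longleftrightarrow> singular_in Y X \<and> dense_in Y X"

end

theory Submission
  imports Defs
begin

text \<open>
  Singularity makes \<open>X\<close> indecomposable: every connected subset of \<open>X\<close> that is not dense in \<open>Y\<close> is
  nowhere dense. Now fix a point \<open>z\<close> and an open set \<open>V\<close> away from \<open>z\<close>. Boundary bumping gives
  connected sets \<open>L\<^sub>k \<subseteq> X - V\<close> that come arbitrarily close to \<open>z\<close> and touch the closure of \<open>V\<close>; after
  a selection they converge to a continuum \<open>H\<close>, which contains \<open>z\<close> and meets the closure of \<open>V\<close>. If
  \<open>H\<close> contained a non-empty open set \<open>W\<close>, the union of \<open>W \<inter> X\<close> with the late \<open>L\<^sub>k\<close> would be a connected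
  subset of \<open>X - V\<close> whose closure has non-empty interior, which is impossible. So \<open>H\<close> is nowhere
  dense and lies in the meager composant of \<open>z\<close>.
\<close>

section \<open>Connected subsets of a singular dense set\<close>

text \<open>In a separation of \<open>A \<union> P\<close> the connected \<open>A\<close> stays on
  one side. The other side then lies in \<open>P\<close>, hence is separated from \<open>Q\<close>
  too, and splits off from all of \<open>X\<close>.\<close>

lemma connectedin_Un_separated_complement:
  assumes X: "connectedin Y X" and A: "connectedin Y A" "A \<subseteq> X"
    and PQ: "X - A = P \<union> Q" "separatedin Y P Q"
  shows "connectedin Y (A \<union> P)"
proof -
  have *: False
    if EF: "E \<union> F = A \<union> P" "E \<noteq> {}" "F \<noteq> {}" "separatedin Y E F" and "A \<subseteq> E" for E F
  proof -
    have "F \<subseteq> P"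
      using EF(1) \<open>A \<subseteq> E\<close> separatedin_imp_disjoint[OF EF(4)] by (auto simp: disjnt_def)
    then have "separatedin Y F Q"
      using PQ(2) separatedin_mono by blast
    then have "separatedin Y F (E \<union> Q)"
      using EF(4) by (simp add: separatedin_sym)
    moreover have "F \<union> (E \<union> Q) = X"
      using EF(1) PQ(1) A(2) by blast
    ultimately show False
      using X EF(2,3) unfolding connectedin_eq_not_separated by blast
  qed
  have "A \<union> P \<subseteq> topspace Y"
    using connectedin_subset_topspace[OF X] A(2) PQ(1) by blast
  moreover have False
    if EF: "E \<union> F = A \<union> P" "E \<noteq> {}" "F \<noteq> {}" "separatedin Y E F" for E F
  proof -
    have "A \<subseteq> E \<or> A \<subseteq> F"
      using connectedin_subset_separated_union[OF A(1) EF(4)] EF(1) by blast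
    then show False
      using *[OF EF] *[of F E] EF by (auto simp: separatedin_sym Un_commute)
  qed
  ultimately show ?thesis
    unfolding connectedin_eq_not_separated by blast
qed

text \<open>Let \<open>X\<close> be singular with respect to \<open>y\<close>, and let
  \<open>A\<close> be the closure of \<open>C\<close> in \<open>X\<close>. Since \<open>A\<close> is
  connected but not dense, \<open>y\<close> misses its closure and so is in the closure of
  \<open>X - A\<close>. This forces \<open>X - A\<close> to be dense, while the interior of the
  closure of \<open>C\<close> is disjoint from it.\<close>

lemma singular_connected_nowhere_dense:
  assumes sing: "singular_in Y X" and dense: "dense_in Y X"
    and C: "connectedin Y C" "C \<subseteq> X" and ne: "Y closure_of C \<noteq> topspace Y"
  shows "nowhere_dense_in Y C"
proof -
  obtain y where X: "connectedin Y X" and y: "y \<in> topspace Y"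
    and eq: "\<And>D. \<lbrakk>D \<subseteq> X; connectedin Y D; y \<in> Y closure_of D\<rbrakk> \<Longrightarrow> subtopology Y X closure_of D = X"
    using sing unfolding singular_in_def singular_wrt_def by blast
  have sub: "X \<subseteq> Y closure_of D" if "D \<subseteq> X" "connectedin Y D" "y \<in> Y closure_of D" for D
    using eq[OF that] closure_of_subtopology_subset[of Y X D] by simp
  have clX: "Y closure_of X = topspace Y" and XY: "X \<subseteq> topspace Y"
    using dense by (auto simp: dense_in_def)
  define A where "A = X \<inter> Y closure_of C"
  have CA: "C \<subseteq> A" "A \<subseteq> Y closure_of C" "A \<subseteq> X"
    using C(2) closure_of_subset[OF connectedin_subset_topspace[OF C(1)]] unfolding A_def by auto
  have A: "connectedin Y A"
    using connectedin_intermediate_closure_of C(1) CA by blast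
  have "y \<notin> Y closure_of D" if "D \<subseteq> X" "connectedin Y D" "Y closure_of D \<noteq> topspace Y" for D
    using sub[OF that(1,2)] that(3) clX closure_of_minimal[of X "Y closure_of D" Y]
      closure_of_subset_topspace[of Y D] by auto
  moreover have clA: "Y closure_of A \<noteq> topspace Y"
    using ne CA(2) closure_of_minimal[of A "Y closure_of C" Y] closure_of_subset_topspace[of Y C]
    by auto
  ultimately have yA: "y \<notin> Y closure_of A"
    using A CA(3) by blast
  have yB: "y \<in> Y closure_of (X - A)"
  proof -
    have "A \<union> (X - A) = X" using CA(3) by blast
    then have "Y closure_of A \<union> Y closure_of (X - A) = topspace Y"
      by (metis closure_of_Un clX)
    then show ?thesis using yA y by blast
  qed
  have "X \<subseteq> Y closure_of (X - A)"
  proof (cases "connectedin Y (X - A)")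
    case True
    then show ?thesis using sub yB by blast
  next
    case False
    then obtain P Q where PQ: "P \<union> Q = X - A" "P \<noteq> {}" "Q \<noteq> {}" "separatedin Y P Q"
      using XY unfolding connectedin_eq_not_separated by blast
    \<comment> \<open>The disconnected case cannot occur: \<open>A \<union> P\<close> is connected
      and has \<open>y\<close> in its closure, so its closure contains \<open>Q\<close>. But
      \<open>Q\<close> avoids the closure of \<open>P\<close> by separation, and that of
      \<open>A\<close> because \<open>A\<close> already contains all points of \<open>X\<close> in
      the closure of \<open>C\<close>.\<close>
    have *: False
      if PQ: "X - A = P \<union> Q" "Q \<noteq> {}" "separatedin Y P Q" and yP: "y \<in> Y closure_of P" for P Q
    proof -
      have "X \<subseteq> Y closure_of (A \<union> P)"
        using sub[OF _ connectedin_Un_separated_complement[OF X A CA(3) PQ(1,3)]] PQ(1) CA(3) yP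
        by (auto simp: closure_of_Un)
      then have "Q \<subseteq> Y closure_of A \<union> Y closure_of P"
        using PQ(1) by (auto simp: closure_of_Un)
      moreover have "Q \<inter> Y closure_of P = {}"
        using PQ(3) by (auto simp: separatedin_def)
      moreover have "Y closure_of A \<subseteq> Y closure_of C"
        by (simp add: CA(2) closure_of_minimal)
      ultimately show False
        using PQ(1,2) unfolding A_def by blast
    qed
    have "y \<in> Y closure_of P \<or> y \<in> Y closure_of Q"
      using yB PQ(1) closure_of_Un by (metis Un_iff)
    then show ?thesis
      using *[of P Q] *[of Q P] PQ by (auto simp: separatedin_sym Un_commute)
  qed
  then have *: "Y closure_of (X - A) = topspace Y"
    using clX by (metis closedin_closure_of closure_of_minimal closure_of_subset_topspace subset_antisym)
  have "Y interior_of (Y closure_of C) \<inter> Y closure_of (X - A) = {}"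
    using interior_of_subset[of Y "Y closure_of C"]
    by (subst openin_Int_closure_of_eq_empty) (auto simp: A_def)
  then have "Y interior_of (Y closure_of C) = {}"
    using * interior_of_subset_topspace[of Y "Y closure_of C"] by auto
  then show ?thesis
    using C XY by (auto simp: nowhere_dense_in_def)
qed

section \<open>Boundary bumping and limits of connected sets\<close>

text \<open>The component of \<open>x\<close> in \<open>K - V\<close> serves as \<open>L\<close>: it
  reaches the frontier of \<open>K - V\<close> relative to \<open>K\<close>, which lies in the
  closure of \<open>V\<close>.\<close>

lemma continuum_boundary_bumping:
  assumes H: "Hausdorff_space Y" and K: "compactin Y K" "connectedin Y K"
    and V: "openin Y V" "K \<inter> V \<noteq> {}" and x: "x \<in> K - V"
  obtains L where "connectedin Y L" "L \<subseteq> K - V" "x \<in> L" "L \<inter> Y closure_of V \<noteq> {}"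
proof -
  let ?K = "subtopology Y K"
  have tK: "topspace ?K = K"
    using K(1) by (rule topspace_subtopology_subset[OF compactin_subset_topspace])
  define L where "L = connected_component_of_set (subtopology ?K (K - V)) x"
  have L: "L \<in> connected_components_of (subtopology ?K (K - V))"
    using x tK unfolding L_def
    by (auto simp: connected_component_in_connected_components_of)
  have cl: "closedin ?K (K - V)"
    by (metis V(1) closedin_def Diff_Diff_Int Diff_subset openin_subtopology_Int2 tK inf_commute)
  have "L \<inter> ?K frontier_of (K - V) \<noteq> {}"
  proof (rule boundary_bumping_theorem_closed[OF _ _ _ cl _ L])
    show "connected_space ?K" "compact_space ?K" "Hausdorff_space ?K"
      using K H by (auto simp: connectedin_def compact_space_subtopology Hausdorff_space_subtopology)
    show "K - V \<noteq> topspace ?K" using V tK by auto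
  qed
  moreover have "?K frontier_of (K - V) \<subseteq> Y closure_of V"
  proof -
    have "?K frontier_of (K - V) \<subseteq> ?K closure_of (K - (K - V))"
      using frontier_of_closures[of ?K "K - V"] unfolding tK by (metis inf_le2)
    also have "\<dots> \<subseteq> Y closure_of (K - (K - V))"
      by (simp add: closure_of_subtopology_subset)
    also have "\<dots> \<subseteq> Y closure_of V"
      by (rule closure_of_mono) auto
    finally show ?thesis .
  qed
  ultimately have 1: "L \<inter> Y closure_of V \<noteq> {}" by blast
  have 2: "connectedin Y L" "L \<subseteq> K - V"
    using connectedin_connected_components_of[OF L] by (auto simp: connectedin_subtopology)
  have 3: "x \<in> L"
    using x tK by (auto simp: L_def connected_component_of_refl)
  show thesis using that[OF 2 3 1] .
qed

text \<open>\<open>H\<close> is the upper limit of the families. If it split into closed sets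
  \<open>E\<close> containing \<open>z\<close> and \<open>F\<close>, these would have disjoint open
  neighbourhoods \<open>U\<close> and \<open>V\<close>. Late members lie in
  \<open>U \<union> V\<close> and meet \<open>U\<close> by \<open>lim\<close>, so being connected
  they stay in \<open>U\<close>, and nothing accumulates at \<open>F\<close>.\<close>

lemma connectedin_limit_of_connected_sets:
  fixes G :: "nat \<Rightarrow> 'a set set"
  assumes Y: "compact_space Y" "Hausdorff_space Y" and dec: "decseq G"
    and ne: "\<And>n. G n \<noteq> {}" and conn: "\<And>n L. L \<in> G n \<Longrightarrow> connectedin Y L"
    and z: "z \<in> topspace Y"
    and lim: "\<And>N. \<lbrakk>openin Y N; z \<in> N\<rbrakk> \<Longrightarrow> \<exists>n. \<forall>L\<in>G n. L \<inter> N \<noteq> {}"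
  defines "H \<equiv> \<Inter>n. Y closure_of \<Union>(G n)"
  shows "z \<in> H" "connectedin Y H"
proof -
  have mono: "G n \<subseteq> G m" if "m \<le> n" for m n
    using dec that by (auto simp: decseq_def)
  have "z \<in> Y closure_of \<Union>(G m)" for m
  proof -
    have "\<exists>w\<in>\<Union>(G m). w \<in> N" if N: "openin Y N" "z \<in> N" for N
    proof -
      obtain n where "\<forall>L\<in>G n. L \<inter> N \<noteq> {}" using lim[OF N] by blast
      moreover obtain L where "L \<in> G (max m n)" using ne by blast
      ultimately show ?thesis
        using mono[of m "max m n"] mono[of n "max m n"] by fastforce
    qed
    then show ?thesis using z unfolding in_closure_of by blast
  qed
  then show zH: "z \<in> H" by (simp add: H_def)
  have cH: "closedin Y H"
    unfolding H_def by (intro closedin_Inter) auto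
  have *: "F = {}"
    if EF: "closedin Y E" "closedin Y F" "E \<inter> F = {}" "E \<union> F = H" and zE: "z \<in> E" for E F
  proof -
    have "normal_space Y"
      using Y compact_Hausdorff_or_regular_imp_normal_space by blast
    then obtain U V where UV: "openin Y U" "openin Y V" "E \<subseteq> U" "F \<subseteq> V" "U \<inter> V = {}"
      using EF by (metis normal_space_def disjnt_def)
    let ?C = "\<lambda>n. Y closure_of \<Union>(G n) - (U \<union> V)"
    \<comment> \<open>Otherwise compactness gives the decreasing closed sets a common point, which
      is in \<open>H\<close> but outside \<open>U \<union> V\<close>.\<close>
    have "\<exists>n. ?C n = {}"
    proof (rule ccontr)
      assume "\<nexists>n. ?C n = {}"
      moreover have "closedin Y (?C n)" for n
        using UV by (intro closedin_diff) auto
      moreover have "decseq ?C"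
        unfolding decseq_def using mono by (meson Diff_mono Union_mono closure_of_mono order_refl)
      ultimately have "(\<Inter>n. ?C n) \<noteq> {}"
        using compact_space_imp_nest[OF Y(1), of ?C] by blast
      moreover have "(\<Inter>n. ?C n) \<subseteq> H - (U \<union> V)" unfolding H_def by blast
      moreover have "H \<subseteq> U \<union> V" using EF(4) UV(3,4) by blast
      ultimately show False by blast
    qed
    then obtain m where m: "Y closure_of \<Union>(G m) \<subseteq> U \<union> V" by blast
    obtain n where n: "\<forall>L\<in>G n. L \<inter> U \<noteq> {}"
      using lim[OF UV(1)] zE UV(3) by blast
    define k where "k = max m n"
    have "L \<subseteq> U" if L: "L \<in> G k" for L
    proof -
      have Lm: "L \<in> G m" "L \<in> G n" using L mono[of m k] mono[of n k] by (auto simp: k_def)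
      then have "\<Union>(G m) \<subseteq> topspace Y"
        using conn connectedin_subset_topspace by blast
      then have "L \<subseteq> U \<union> V" using closure_of_subset m Lm by fastforce
      moreover have "separatedin Y U V" using UV by (simp add: separatedin_open_sets disjnt_def)
      ultimately have "L \<subseteq> U \<or> L \<subseteq> V"
        using connectedin_subset_separated_union conn[OF L] by blast
      then show ?thesis using n Lm UV(5) by blast
    qed
    then have "V \<inter> \<Union>(G k) = {}" using UV(5) by blast
    then have "V \<inter> Y closure_of \<Union>(G k) = {}"
      using UV(2) openin_Int_closure_of_eq_empty by blast
    then show "F = {}" using EF(4) UV(4) unfolding H_def by blast
  qed
  have False
    if EF: "closedin Y E" "closedin Y F" "H \<subseteq> E \<union> F" "E \<inter> F \<inter> H = {}" "E \<inter> H \<noteq> {}" "F \<inter> H \<noteq> {}" for E F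
  proof -
    have "closedin Y (E \<inter> H)" "closedin Y (F \<inter> H)" using EF cH by auto
    moreover have "(E \<inter> H) \<inter> (F \<inter> H) = {}" "(E \<inter> H) \<union> (F \<inter> H) = H" using EF by auto
    ultimately show False
      using *[of "E \<inter> H" "F \<inter> H"] *[of "F \<inter> H" "E \<inter> H"] EF zH by (auto simp: Int_commute Un_commute)
  qed
  then show "connectedin Y H"
    unfolding connectedin_closedin using closedin_subset[OF cH] by blast
qed

section \<open>A countable base, selection of subfamilies, and unions with an open piece\<close>

lemma compact_metrizable_imp_second_countable:
  assumes "compact_space Y" "metrizable_space Y"
  shows "second_countable Y"
proof -
  obtain M d where Md: "Metric_space M d" and Y: "Y = Metric_space.mtopology M d"
    using assms(2) metrizable_space_def by blast
  interpret Metric_space M d by (rule Md)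
  have "\<exists>K. finite K \<and> K \<subseteq> M \<and> M \<subseteq> (\<Union>x\<in>K. mball x (1 / Suc n))" for n
    using assms(1) compact_space_eq_mcomplete_mtotally_bounded Y
    by (auto simp: mtotally_bounded_def)
  then obtain K where K: "\<And>n. finite (K n)" "\<And>n. K n \<subseteq> M"
      "\<And>n. M \<subseteq> (\<Union>x\<in>K n. mball x (1 / Suc n))"
    by metis
  define B where "B = (\<Union>n. (\<lambda>x. mball x (1 / Suc n)) ` K n)"
  have "countable B"
    unfolding B_def by (intro countable_UN countable_image) (auto simp: K countable_finite)
  moreover have "\<forall>V\<in>B. openin Y V" by (auto simp: B_def Y)
  moreover have "\<exists>V\<in>B. x \<in> V \<and> V \<subseteq> U" if U: "openin Y U" "x \<in> U" for U x
  proof -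
    obtain r where r: "r > 0" "mball x r \<subseteq> U" and x: "x \<in> M"
      using U unfolding Y openin_mtopology by blast
    \<comment> \<open>The covering ball is centred at \<open>k\<close>, not at \<open>x\<close>;
      half the radius pays for the distance between them.\<close>
    obtain n where n: "1 / Suc n < r / 2"
      using r(1) nat_approx_posE[of "r/2"] by (metis half_gt_zero)
    obtain k where k: "k \<in> K n" "x \<in> mball k (1 / Suc n)"
      using K(3)[of n] x by blast
    have "mball k (1 / Suc n) \<subseteq> mball x r"
    proof
      fix w assume w: "w \<in> mball k (1 / Suc n)"
      then have "d x w \<le> d k x + d k w"
        using k x by (metis commute in_mball triangle)
      then show "w \<in> mball x r" using w k n x by (auto simp: in_mball)
    qed
    then show ?thesis using k r by (auto simp: B_def)
  qed
  ultimately show ?thesis unfolding second_countable_def by blast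
qed
text \<open>This replaces the extraction of a convergent subsequence. For each \<open>B n\<close> in
  turn, keep either the members meeting it or those missing it; one of the two halves still
  accumulates at \<open>z\<close>. With \<open>B\<close> enumerating a base, upper limit points
  become lower limit points.\<close>

lemma eventually_deciding_subfamilies:
  fixes B :: "nat \<Rightarrow> 'a set"
  assumes F: "\<And>N. \<lbrakk>openin Y N; z \<in> N\<rbrakk> \<Longrightarrow> \<exists>L\<in>F. L \<inter> N \<noteq> {}"
  obtains G where "decseq G" "\<And>n. G n \<subseteq> F"
    "\<And>n N. \<lbrakk>openin Y N; z \<in> N\<rbrakk> \<Longrightarrow> \<exists>L\<in>G n. L \<inter> N \<noteq> {}"
    "\<And>n. (\<forall>L\<in>G (Suc n). L \<inter> B n \<noteq> {}) \<or> (\<forall>L\<in>G (Suc n). L \<inter> B n = {})"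
proof -
  define R where "R = (\<lambda>G. \<forall>N. openin Y N \<and> z \<in> N \<longrightarrow> (\<exists>L\<in>G. L \<inter> N \<noteq> {}))"
  \<comment> \<open>\<open>R\<close> is the invariant of the recursion. If \<open>G1\<close> misses
    a neighbourhood \<open>N\<close> of \<open>z\<close>, then whatever meets
    \<open>N \<inter> N'\<close> comes from \<open>G2\<close>.\<close>
  have R_Un: "R G2" if G: "R (G1 \<union> G2)" "\<not> R G1" for G1 G2
  proof -
    obtain N where N: "openin Y N" "z \<in> N" "\<forall>L\<in>G1. L \<inter> N = {}"
      using G(2) unfolding R_def by auto
    have "\<exists>L\<in>G2. L \<inter> N' \<noteq> {}" if N': "openin Y N'" "z \<in> N'" for N'
    proof -
      have "openin Y (N \<inter> N')" "z \<in> N \<inter> N'" using N N' by auto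
      then obtain L where L: "L \<in> G1 \<union> G2" "L \<inter> (N \<inter> N') \<noteq> {}"
        using G(1) unfolding R_def by meson
      moreover from L have "L \<notin> G1" using N(3) by blast
      ultimately show ?thesis by blast
    qed
    then show ?thesis by (simp add: R_def)
  qed
  define hit where "hit = (\<lambda>n G. {L \<in> G. L \<inter> B n \<noteq> {}})"
  \<comment> \<open>The members meeting \<open>B n\<close> are preferred; when they fail
    \<open>R\<close>, the rest satisfy it by \<open>R_Un\<close>. The choice about
    \<open>B n\<close> takes effect at index \<open>Suc n\<close>.\<close>
  define G where "G = rec_nat F (\<lambda>n G. if R (hit n G) then hit n G else G - hit n G)"
  have G0: "G 0 = F" and GSuc: "G (Suc n) = (if R (hit n (G n)) then hit n (G n) else G n - hit n (G n))" for n
    by (auto simp: G_def)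
  have sub: "G (Suc n) \<subseteq> G n" for n
    by (auto simp: GSuc hit_def)
  then have dec: "decseq G" by (simp add: decseq_Suc_iff)
  have RG: "R (G n)" for n
  proof (induction n)
    case 0
    then show ?case using F by (auto simp: R_def G0)
  next
    case (Suc n)
    have "hit n (G n) \<union> (G n - hit n (G n)) = G n" by (auto simp: hit_def)
    with Suc show ?case using R_Un[of "hit n (G n)" "G n - hit n (G n)"] by (simp add: GSuc)
  qed
  show thesis
  proof
    show "G n \<subseteq> F" for n
      using dec G0 by (metis decseq_def le0)
    show "(\<forall>L\<in>G (Suc n). L \<inter> B n \<noteq> {}) \<or> (\<forall>L\<in>G (Suc n). L \<inter> B n = {})" for n
      by (auto simp: GSuc hit_def)
    show "\<exists>L\<in>G n. L \<inter> N \<noteq> {}" if "openin Y N" "z \<in> N" for n N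
      using RG[of n] that unfolding R_def by blast
  qed (rule dec)
qed

text \<open>The sets \<open>L\<close> of a late \<open>G n\<close> meet any two given non-empty open pieces of \<open>W\<close>, so no
  separation of the union can split \<open>W \<inter> X\<close>.\<close>

lemma connectedin_Union_Un_limit:
  fixes G :: "nat \<Rightarrow> 'a set set"
  assumes dec: "decseq G" and ne: "\<And>n. G n \<noteq> {}"
    and conn: "\<And>L. L \<in> G m \<Longrightarrow> connectedin Y L" and sub: "\<And>L. L \<in> G m \<Longrightarrow> L \<subseteq> X"
    and W: "openin Y W" and X: "X \<subseteq> topspace Y"
    and hit: "\<And>N. \<lbrakk>openin Y N; N \<subseteq> W; N \<noteq> {}\<rbrakk> \<Longrightarrow> \<exists>n. \<forall>L\<in>G n. L \<inter> N \<noteq> {}"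
    and meet: "\<And>L. L \<in> G m \<Longrightarrow> L \<inter> W \<noteq> {}"
  shows "connectedin Y (\<Union>(G m) \<union> W \<inter> X)"
proof -
  let ?D = "\<Union>(G m) \<union> W \<inter> X"
  \<comment> \<open>A side containing \<open>W \<inter> X\<close> absorbs every member of
    \<open>G m\<close>, since each meets \<open>W\<close> at a point of \<open>X\<close>.\<close>
  have *: False if C: "C1 \<union> C2 = ?D" "C2 \<noteq> {}" "separatedin Y C1 C2" and WC: "W \<inter> X \<subseteq> C1" for C1 C2
  proof -
    have "C1 \<inter> C2 = {}"
      using separatedin_imp_disjoint[OF C(3)] by (simp add: disjnt_def)
    have "L \<subseteq> C1" if L: "L \<in> G m" for L
    proof -
      have "L \<inter> C1 \<noteq> {}"
        using meet[OF L] sub[OF L] WC by blast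
      moreover have "L \<subseteq> C1 \<or> L \<subseteq> C2"
        using connectedin_subset_separated_union[OF conn[OF L] C(3)] C(1) L by blast
      ultimately show ?thesis using \<open>C1 \<inter> C2 = {}\<close> by blast
    qed
    then have "?D \<subseteq> C1" using WC by blast
    then show False using C(1,2) \<open>C1 \<inter> C2 = {}\<close> by blast
  qed
  have late: "\<exists>n. \<forall>L\<in>G n. L \<inter> C1 \<noteq> {}"
    if C: "C1 \<union> C2 = ?D" "separatedin Y C1 C2" and "W \<inter> X \<inter> C1 \<noteq> {}" for C1 C2
  proof -
    \<comment> \<open>Removing the closure of \<open>C2\<close> leaves an open piece of
      \<open>W\<close> that still contains the points of \<open>C1\<close> in \<open>W\<close>; a
      member of \<open>G m\<close> can meet it only in \<open>C1\<close>.\<close>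
    have "openin Y (W - Y closure_of C2)" using W by (intro openin_diff) auto
    moreover have "W - Y closure_of C2 \<noteq> {}"
      using that unfolding separatedin_def by blast
    ultimately obtain n where n: "\<forall>L\<in>G n. L \<inter> (W - Y closure_of C2) \<noteq> {}"
      using hit[of "W - Y closure_of C2"] by blast
    have C2: "C2 \<subseteq> Y closure_of C2"
      using C(2) closure_of_subset unfolding separatedin_def by blast
    have "L \<inter> C1 \<noteq> {}" if L: "L \<in> G (max m n)" for L
    proof -
      have "L \<in> G m" "L \<in> G n"
        using L decseqD[OF dec, of m "max m n"] decseqD[OF dec, of n "max m n"] by auto
      then show ?thesis using n C(1) C2 by blast
    qed
    then show ?thesis by blast
  qed
  have False if C: "C1 \<union> C2 = ?D" "C1 \<noteq> {}" "C2 \<noteq> {}" "separatedin Y C1 C2" for C1 C2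
  proof -
    have C': "C2 \<union> C1 = ?D" "separatedin Y C2 C1"
      using C by (auto simp: separatedin_sym)
    have "\<not> W \<inter> X \<subseteq> C1" "\<not> W \<inter> X \<subseteq> C2"
      using *[of C1 C2] *[of C2 C1] C C' by blast+
    then have "W \<inter> X \<inter> C1 \<noteq> {}" "W \<inter> X \<inter> C2 \<noteq> {}" using C(1) by blast+
    then obtain i j where ij: "\<forall>L\<in>G i. L \<inter> C1 \<noteq> {}" "\<forall>L\<in>G j. L \<inter> C2 \<noteq> {}"
      using late[OF C(1,4)] late[OF C'] by blast
    \<comment> \<open>The sum of the indices is late enough for all three families: this connected
      \<open>L\<close> lies in \<open>?D\<close> and meets both sides.\<close>
    obtain L where L: "L \<in> G (m + i + j)" using ne by blast
    then have "L \<in> G m" "L \<in> G i" "L \<in> G j"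
      using decseqD[OF dec, of m "m + i + j"] decseqD[OF dec, of i "m + i + j"]
        decseqD[OF dec, of j "m + i + j"] by auto
    moreover from this have "L \<subseteq> C1 \<or> L \<subseteq> C2"
      using connectedin_subset_separated_union[OF conn C(4)] C(1) by blast
    ultimately show False
      using ij separatedin_imp_disjoint[OF C(4)] unfolding disjnt_def by blast
  qed
  moreover have "?D \<subseteq> topspace Y" using sub X by blast
  ultimately show ?thesis unfolding connectedin_eq_not_separated by blast
qed

section \<open>A nowhere dense subcontinuum from a point to an open set\<close>

text \<open>The \<open>H\<close> obtained is a witness that the meager composant of \<open>z\<close>
  meets \<open>U\<close>. Meager composants satisfy \<open>join\<close>, which supplies the compact
  connected sets for boundary bumping.\<close>

lemma nowhere_dense_subcontinuum_through_point:
  assumes Y: "compact_space Y" "metrizable_space Y"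
    and sing: "singular_in Y X" and dense: "dense_in Y X"
    and join: "\<And>x v. \<lbrakk>x \<in> X; v \<in> X\<rbrakk> \<Longrightarrow> \<exists>K. compactin Y K \<and> connectedin Y K \<and> K \<subseteq> X \<and> x \<in> K \<and> v \<in> K"
    and z: "z \<in> topspace Y" and U: "openin Y U" and a: "a \<in> U" "a \<noteq> z"
  obtains H where "subcontinuum Y H" "nowhere_dense_in Y H" "z \<in> H" "H \<inter> U \<noteq> {}"
proof -
  have Haus: "Hausdorff_space Y"
    using Y metrizable_imp_Hausdorff_space by blast
  have XY: "X \<subseteq> topspace Y" and clX: "Y closure_of X = topspace Y"
    using dense by (auto simp: dense_in_def)
  have "openin Y (U - {z})"
    using U z Haus by (simp add: open_in_Hausdorff_delete)
  moreover have "a \<in> U - {z}" using a by blast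
  moreover have "regular_space Y" using Y(2) metrizable_imp_regular_space by blast
  ultimately obtain V K where V: "openin Y V" "a \<in> V" "V \<subseteq> K" and K: "closedin Y K" "K \<subseteq> U - {z}"
    unfolding neighbourhood_base_of_closedin[symmetric] neighbourhood_base_of by metis
  \<comment> \<open>Thus points close to \<open>z\<close> are off the closure of \<open>V\<close>,
    and whatever meets that closure meets \<open>U\<close>.\<close>
  have clV: "Y closure_of V \<subseteq> U - {z}"
    using closure_of_minimal[OF V(3) K(1)] K(2) by blast
  have meetsX: "X \<inter> N \<noteq> {}" if "openin Y N" "N \<noteq> {}" for N
    using that dense_intersects_open[of Y X] clX by (metis Int_commute)

  define F where "F = {L. connectedin Y L \<and> L \<subseteq> X - V \<and> L \<inter> Y closure_of V \<noteq> {}}"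
  \<comment> \<open>Join a point of \<open>X\<close> near \<open>z\<close> to a point of
    \<open>X\<close> in \<open>V\<close> inside \<open>X\<close>, and cut the joining set off at
    \<open>V\<close> by boundary bumping.\<close>
  have F: "\<exists>L\<in>F. L \<inter> N \<noteq> {}" if N: "openin Y N" "z \<in> N" for N
  proof -
    have "openin Y (N - Y closure_of V)" using N by (intro openin_diff) auto
    moreover have "z \<in> N - Y closure_of V" using N clV by blast
    ultimately obtain x where x: "x \<in> X" "x \<in> N" "x \<notin> Y closure_of V"
      using meetsX[of "N - Y closure_of V"] by blast
    obtain v where v: "v \<in> X" "v \<in> V" using meetsX[OF V(1)] V(2) by blast
    obtain C where C: "compactin Y C" "connectedin Y C" "C \<subseteq> X" "x \<in> C" "v \<in> C"
      using join[OF x(1) v(1)] by blast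
    have "x \<in> C - V"
      using C x closure_of_subset[OF openin_subset[OF V(1)]] by blast
    then obtain L where "connectedin Y L" "L \<subseteq> C - V" "x \<in> L" "L \<inter> Y closure_of V \<noteq> {}"
      using continuum_boundary_bumping[OF Haus C(1,2) V(1)] C(5) v(2) by (metis IntI empty_iff)
    then have "L \<in> F" "x \<in> L \<inter> N" using C x by (auto simp: F_def)
    then show ?thesis by blast
  qed

  obtain \<B> where \<B>: "countable \<B>" "\<forall>V\<in>\<B>. openin Y V"
    "\<And>U x. \<lbrakk>openin Y U; x \<in> U\<rbrakk> \<Longrightarrow> \<exists>V\<in>\<B>. x \<in> V \<and> V \<subseteq> U"
    using compact_metrizable_imp_second_countable[OF Y] unfolding second_countable_def by metis
  have "\<B> \<noteq> {}" using \<B>(3)[OF U a(1)] by blast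
  define B where "B = from_nat_into \<B>"
  have B_open: "openin Y (B n)" for n
    unfolding B_def using \<B>(2) from_nat_into[OF \<open>\<B> \<noteq> {}\<close>] by blast
  have B: "\<exists>n. x \<in> B n \<and> B n \<subseteq> N" if "openin Y N" "x \<in> N" for x N
    using \<B>(3)[OF that] from_nat_into_surj[OF \<B>(1)] unfolding B_def by metis

  obtain G where dec: "decseq G" and GF: "\<And>n. G n \<subseteq> F"
    and Gz: "\<And>n N. \<lbrakk>openin Y N; z \<in> N\<rbrakk> \<Longrightarrow> \<exists>L\<in>G n. L \<inter> N \<noteq> {}"
    and decide: "\<And>n. (\<forall>L\<in>G (Suc n). L \<inter> B n \<noteq> {}) \<or> (\<forall>L\<in>G (Suc n). L \<inter> B n = {})"
    using eventually_deciding_subfamilies[of Y z F B, OF F] by blast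
  have ne: "G n \<noteq> {}" for n using Gz[of "topspace Y"] z by blast
  have GL: "connectedin Y L" "L \<subseteq> X - V" "L \<inter> Y closure_of V \<noteq> {}" if "L \<in> G n" for n L
    using that GF[of n] by (auto simp: F_def)
  define H where "H = (\<Inter>n. Y closure_of \<Union>(G n))"
  have GY: "\<Union>(G n) \<subseteq> topspace Y" for n using GL(2) XY by blast

  \<comment> \<open>Some member of \<open>G (Suc n)\<close> meets the basic neighbourhood
    \<open>B n\<close> of \<open>p\<close>, so by \<open>decide\<close> all of them do.\<close>
  have hit: "\<exists>n. \<forall>L\<in>G n. L \<inter> N \<noteq> {}" if N: "openin Y N" "p \<in> N" and p: "\<And>n. p \<in> Y closure_of \<Union>(G n)" for N p
  proof -
    obtain n where n: "p \<in> B n" "B n \<subseteq> N" using B[OF N] by blast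
    have "\<exists>q\<in>\<Union>(G (Suc n)). q \<in> B n"
      using p[of "Suc n"] n(1) B_open[of n] unfolding in_closure_of by blast
    then have "\<forall>L\<in>G (Suc n). L \<inter> B n \<noteq> {}" using decide[of n] by blast
    then show ?thesis using n(2) by blast
  qed
  have zcl: "z \<in> Y closure_of \<Union>(G n)" for n
    unfolding in_closure_of using z Gz by blast
  have H: "z \<in> H" "connectedin Y H"
    unfolding H_def using connectedin_limit_of_connected_sets[OF Y(1) Haus dec ne _ z] GL(1) hit[OF _ _ zcl]
    by simp_all
  have cH: "closedin Y H" unfolding H_def by (intro closedin_Inter) auto
  have HV: "H \<inter> V = {}"
  proof -
    have "V \<inter> \<Union>(G 0) = {}" using GL(2) by blast
    then have "V \<inter> Y closure_of \<Union>(G 0) = {}"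
      using V(1) openin_Int_closure_of_eq_empty by blast
    then show ?thesis unfolding H_def by blast
  qed

  \<comment> \<open>Every member touches the closure of \<open>V\<close>; compactness passes this on
    to \<open>H\<close>.\<close>
  have "(\<Inter>n. Y closure_of \<Union>(G n) \<inter> Y closure_of V) \<noteq> {}"
  proof (rule compact_space_imp_nest[OF Y(1)])
    show "closedin Y (Y closure_of \<Union>(G n) \<inter> Y closure_of V)" for n
      by (intro closedin_Int) auto
    show "Y closure_of \<Union>(G n) \<inter> Y closure_of V \<noteq> {}" for n
    proof -
      obtain L where L: "L \<in> G n" using ne by blast
      then have "L \<subseteq> Y closure_of \<Union>(G n)" using closure_of_subset[OF GY[of n]] by blast
      then show ?thesis using GL(3)[OF L] by blast
    qed
    show "decseq (\<lambda>n. Y closure_of \<Union>(G n) \<inter> Y closure_of V)"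
      using dec unfolding decseq_def by (meson Int_mono Union_mono closure_of_mono order_refl)
  qed
  then have HU: "H \<inter> U \<noteq> {}" using clV unfolding H_def by blast

  have "Y interior_of H = {}"
  proof (rule ccontr)
    define W where "W = Y interior_of H"
    assume "Y interior_of H \<noteq> {}"
    then obtain w where w: "w \<in> W" by (auto simp: W_def)
    have W: "openin Y W" "W \<subseteq> H" by (auto simp: W_def interior_of_subset)
    have hitW: "\<exists>n. \<forall>L\<in>G n. L \<inter> N \<noteq> {}" if N: "openin Y N" "N \<subseteq> W" "N \<noteq> {}" for N
    proof -
      obtain p where "p \<in> N" using N(3) by blast
      then show ?thesis using hit[OF N(1)] N(2) W(2) unfolding H_def by blast
    qed
    obtain m where m: "\<forall>L\<in>G m. L \<inter> W \<noteq> {}" using hitW[OF W(1)] w by blast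
    \<comment> \<open>Its closure misses \<open>V\<close>, so \<open>D\<close> must be nowhere
      dense; yet \<open>W \<inter> X\<close> is dense in \<open>W\<close>, so that closure contains
      \<open>W\<close>.\<close>
    define D where "D = \<Union>(G m) \<union> W \<inter> X"
    have D: "connectedin Y D"
      unfolding D_def
    proof (rule connectedin_Union_Un_limit[OF dec ne GL(1) _ W(1) XY hitW])
      show "L \<subseteq> X" if "L \<in> G m" for L using GL(2)[OF that] by blast
    qed (use m in auto)
    have "D \<subseteq> X" "V \<inter> D = {}" using GL(2) W(2) HV unfolding D_def by blast+
    moreover have "V \<inter> Y closure_of D = {}"
      using \<open>V \<inter> D = {}\<close> V(1) openin_Int_closure_of_eq_empty by blast
    then have "Y closure_of D \<noteq> topspace Y"
      using V(1,2) openin_subset by fastforce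
    ultimately have "nowhere_dense_in Y D"
      using singular_connected_nowhere_dense[OF sing dense D] by blast
    moreover have "W \<subseteq> Y closure_of D"
    proof -
      have "W \<subseteq> Y closure_of (W \<inter> X)"
        using openin_Int_closure_of_subset[OF W(1), of X] clX openin_subset[OF W(1)] by blast
      then show ?thesis using closure_of_mono[of "W \<inter> X" D Y] unfolding D_def by blast
    qed
    ultimately show False
      using interior_of_maximal[OF _ W(1)] w unfolding nowhere_dense_in_def by blast
  qed
  then have "nowhere_dense_in Y H"
    using cH closedin_subset by (simp add: nowhere_dense_in_def closure_of_closedin)
  moreover have "subcontinuum Y H"
    using H closedin_compact_space[OF Y(1) cH] by (auto simp: subcontinuum_def)
  ultimately show thesis using that H(1) HU by blast
qed

section \<open>Density of every meager composant\<close>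

lemma meager_composant_of_join:
  assumes "x \<in> meager_composant_of Y p" "v \<in> meager_composant_of Y p"
  shows "\<exists>K. compactin Y K \<and> connectedin Y K \<and> K \<subseteq> meager_composant_of Y p \<and> x \<in> K \<and> v \<in> K"
proof -
  obtain K where K: "subcontinuum Y K" "nowhere_dense_in Y K" "p \<in> K" "x \<in> K"
    using assms(1) unfolding meager_composant_of_def by blast
  obtain L where L: "subcontinuum Y L" "nowhere_dense_in Y L" "p \<in> L" "v \<in> L"
    using assms(2) unfolding meager_composant_of_def by blast
  have "compactin Y (K \<union> L)" "connectedin Y (K \<union> L)"
    using K L by (auto simp: subcontinuum_def intro: compactin_Un connectedin_Un)
  moreover have "K \<union> L \<subseteq> meager_composant_of Y p"
    using K L unfolding meager_composant_of_def by blast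
  ultimately show ?thesis using K(4) L(4) by blast
qed

theorem corollary1p2:
  fixes Y :: "'a topology"
  assumes "continuum Y"
    and "\<exists>X. meager_composant Y X \<and> singular_dense_in Y X"
  shows "\<forall>X. meager_composant Y X \<longrightarrow> dense_in Y X"
proof (intro allI impI)
  fix M
  assume "meager_composant Y M"
  then obtain z where z: "z \<in> topspace Y" and M: "M = meager_composant_of Y z"
    unfolding meager_composant_def by blast
  obtain p where sing: "singular_in Y (meager_composant_of Y p)"
    and dense: "dense_in Y (meager_composant_of Y p)"
    using assms(2) unfolding meager_composant_def singular_dense_in_def by blast
  have Y: "compact_space Y" "metrizable_space Y"
    and nontriv: "\<exists>a\<in>topspace Y. \<exists>b\<in>topspace Y. a \<noteq> b"
    using assms(1) unfolding continuum_def by blast+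
  \<comment> \<open>That \<open>z \<in> M\<close> is not immediate from the definition, as it
    requires a nowhere dense subcontinuum through \<open>z\<close>; it is read off from
    \<open>H\<close> here.\<close>
  have meets: "z \<in> M \<and> M \<inter> U \<noteq> {}" if U: "openin Y U" "a \<in> U" "a \<noteq> z" for U a
  proof -
    obtain H where H: "subcontinuum Y H" "nowhere_dense_in Y H" "z \<in> H" "H \<inter> U \<noteq> {}"
      using nowhere_dense_subcontinuum_through_point[OF Y sing dense meager_composant_of_join z U] .
    then have "H \<subseteq> M" unfolding M meager_composant_of_def by blast
    then show ?thesis using H by blast
  qed
  \<comment> \<open>A second point of \<open>Y\<close> allows \<open>meets\<close> to be applied to
    the whole space.\<close>
  obtain b where b: "b \<in> topspace Y" "b \<noteq> z" using nontriv by metis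
  have zM: "z \<in> M" using meets[OF openin_topspace b] by blast
  have "M \<inter> U \<noteq> {}" if U: "openin Y U" "U \<noteq> {}" for U
  \<comment> \<open>If \<open>U\<close> has no point besides \<open>z\<close>, then
    \<open>meets\<close> does not apply, but \<open>U\<close> is \<open>{z}\<close> and
    \<open>zM\<close> suffices.\<close>
  proof (cases "U \<subseteq> {z}")
    case True
    then show ?thesis using zM U by blast
  next
    case False
    then show ?thesis using meets[OF U(1)] by blast
  qed
  then have "Y closure_of M = topspace Y"
    unfolding dense_intersects_open by (metis Int_commute)
  moreover have "M \<subseteq> topspace Y"
    unfolding M meager_composant_of_def nowhere_dense_in_def by blast
  ultimately show "dense_in Y M" unfolding dense_in_def by blast
qed

end
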